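(* For a real sequence $\{g_n\}_{n\ge0}$ and fixed $0<q<1$ define $$g(\mu;x)=\sum_{n=0}^{\infty}\frac{g_nx^n}{\Gamma_q(\mu+n)} .$$ Suppose $\{g_n\}_{n\ge0}$ is doubly positive. Then this series has a positive radius of convergence $R_g$, and the generalized Turánian $$\Delta_g(\alpha,\beta;x)=g(\mu+\alpha;x)g(\mu+\beta;x)-g(\mu;x)g(\mu+\alpha+\beta;x)$$ is positive for $0<x<R_g$ if $\alpha\in\{1,2,3,\dots\}$, $\beta>0$ and $\mu\ge\max(-\beta,-1)$. If, in addition, $\alpha\le\beta+1$, then $\Delta_g(\alpha,\beta;x)$ has positive power series coefficients at all powers of $x$.
   Context: For $0<q<1$: $(a;q)_0=1$, $(a;q)_n=\prod_{k=0}^{n-1}(1-aq^k)$ for $n\ge1$, $(a;q)_\infty=\lim_{n\to\infty}(a;q)_n$, and the $q$-gamma function is $\Gamma_q(z)=(1-q)^{1-z}\dfrac{(q;q)_\infty}{(q^z;q)_\infty}$; its reciprocal $1/\Gamma_q(z)=(1-q)^{z-1}(q^z;q)_\infty/(q;q)_\infty$ equals $0$ at $z=0,-1,-2,\dots$. A sequence $\{g_n\}_{n\ge0}$ of nonnegative reals is doubly positive if it is nontrivial (not identically zero), is log-concave ($g_k^2\ge g_{k-1}g_{k+1}$ for all $k\ge1$), and has no internal zeros ($g_N=0$ implies that either $g_{N+i}=0$ for all $i\ge0$, or $g_{N-i}=0$ for $i=0,\dots,N$).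
   Formalization: "Positive" is ≥0, and >0 except: Δ if μ=−1 and (α=1 or β=1, g_n=0 for n≥1; or α=β=1, g_n=g_0r^n); x^m coefficient if all g_kg_{m−k}=0, or μ=−1 and (m=0, α=1 or β=1; or α=β=1, all g_kg_{m−k} equal). These are 0. *)

theory Defs
  imports "HOL-Analysis.Analysis"
begin

definition qpoch :: "real \<Rightarrow> real \<Rightarrow> nat \<Rightarrow> real" where
  "qpoch a q n = (\<Prod>k<n. 1 - a * q ^ k)"

definition qpoch_inf :: "real \<Rightarrow> real \<Rightarrow> real" where
  "qpoch_inf a q = lim (\<lambda>n. qpoch a q n)"

text \<open>
  At \<open>z = 0, -1, -2, \<dots>\<close> the denominator vanishes, so by \<open>x / 0 = 0\<close> the value of
  \<open>qGamma q z\<close> is \<open>0\<close> and the reciprocal \<open>1 / qGamma q z\<close> is \<open>0\<close> as well; the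
  reciprocal thus agrees everywhere with the continuous function in the lemma below.
\<close>

definition qGamma :: "real \<Rightarrow> real \<Rightarrow> real" where
  "qGamma q z = (1 - q) powr (1 - z) * qpoch_inf q q / qpoch_inf (q powr z) q"

lemma one_over_qGamma:
  "1 / qGamma q z = (1 - q) powr (z - 1) * qpoch_inf (q powr z) q / qpoch_inf q q"
proof -
  have "(1 - q) powr (z - 1) = inverse ((1 - q) powr (1 - z))"
    by (metis minus_diff_eq powr_minus)
  then show ?thesis
    by (simp add: qGamma_def field_simps)
qed

definition doubly_positive :: "(nat \<Rightarrow> real) \<Rightarrow> bool" where
  "doubly_positive g \<longleftrightarrow>
     (\<forall>n. g n \<ge> 0) \<and>
     (\<exists>n. g n \<noteq> 0) \<and>
     (\<forall>k\<ge>1. (g k)\<^sup>2 \<ge> g (k - 1) * g (k + 1)) \<and>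
     (\<forall>N. g N = 0 \<longrightarrow> (\<forall>i. g (N + i) = 0) \<or> (\<forall>i\<le>N. g (N - i) = 0))"

definition qseries_coeff :: "real \<Rightarrow> (nat \<Rightarrow> real) \<Rightarrow> real \<Rightarrow> nat \<Rightarrow> real" where
  "qseries_coeff q g \<mu> n = g n / qGamma q (\<mu> + real n)"

definition qseries :: "real \<Rightarrow> (nat \<Rightarrow> real) \<Rightarrow> real \<Rightarrow> real \<Rightarrow> real" where
  "qseries q g \<mu> x = (\<Sum>n. qseries_coeff q g \<mu> n * x ^ n)"

definition gen_turanian ::
    "real \<Rightarrow> (nat \<Rightarrow> real) \<Rightarrow> real \<Rightarrow> real \<Rightarrow> real \<Rightarrow> real \<Rightarrow> real" where
  "gen_turanian q g \<mu> \<alpha> \<beta> x =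
     qseries q g (\<mu> + \<alpha>) x * qseries q g (\<mu> + \<beta>) x
     - qseries q g \<mu> x * qseries q g (\<mu> + \<alpha> + \<beta>) x"

end

theory Submission
  imports Defs
begin

text \<open>
  Write \<open>h z = 1 / \<Gamma>\<^sub>q(z)\<close>, so that \<open>h z = [z]\<^sub>q h (z + 1)\<close>. For \<open>\<alpha> = 1\<close> the \<open>m\<close>-th
  coefficient of the Turanian is \<open>\<Sum>k\<le>m. w k * (u (k + 1) - u k)\<close> with
  \<open>w k = g k * g (m - k)\<close> and \<open>u k = h (\<mu> + k) * h (\<mu> + \<beta> + 1 + m - k)\<close>. As \<open>w\<close> is symmetric and
  increases up to \<open>m / 2\<close>, Abel summation turns this into
  \<open>\<Sum>2j\<le>m. (w j - w (j - 1)) * (u (m + 1 - j) - u j)\<close>, where every factor is nonnegative, the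
  second one by the recurrence for \<open>h\<close>.

  The Turanian for general \<open>\<alpha>\<close> is the telescoping sum of the Turanians at \<open>\<mu> + j\<close> with parameters
  \<open>1\<close> and \<open>\<beta> + \<alpha> - 1 - 2j\<close>, \<open>j < \<alpha>\<close>; these parameters are nonnegative precisely when
  \<open>\<alpha> \<le> \<beta> + 1\<close>. Without this condition one multiplies the inequalities for the consecutive
  quotients \<open>g(\<mu> + j + 1; x) / g(\<mu> + j; x)\<close> instead.
\<close>

section \<open>The reciprocal q-gamma function\<close>

lemma qpoch_Suc_shift: "qpoch a q (Suc n) = (1 - a) * qpoch (a * q) q n"
  unfolding qpoch_def by (subst prod.lessThan_Suc_shift) (simp add: mult.assoc power_commutes)

text \<open>\<open>convergent_prod\<close> asks for a nonzero limit once finitely many factors are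
  dropped; this is what makes the limit strictly positive in \<open>qpoch_inf_pos\<close>.\<close>

lemma convergent_prod_qpoch:
  fixes q :: real
  assumes "0 < q" "q < 1"
  shows "convergent_prod (\<lambda>k. 1 - a * q ^ k)"
proof -
  have "summable (\<lambda>k. norm (1 - a * q ^ k - 1))"
    using assms by (simp add: abs_mult power_abs summable_mult)
  then show ?thesis
    by (intro abs_convergent_prod_imp_convergent_prod summable_imp_abs_convergent_prod)
qed

lemma qpoch_LIMSEQ_prodinf:
  fixes q :: real
  assumes "0 < q" "q < 1"
  shows "qpoch a q \<longlonglongrightarrow> (\<Prod>k. 1 - a * q ^ k)"
  using convergent_prod_LIMSEQ [OF convergent_prod_qpoch [OF assms]]
  by (subst (asm) LIMSEQ_lessThan_iff_atMost [symmetric]) (simp add: qpoch_def [abs_def])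

lemma qpoch_inf_eq_prodinf:
  fixes q :: real
  assumes "0 < q" "q < 1"
  shows "qpoch_inf a q = (\<Prod>k. 1 - a * q ^ k)"
  using qpoch_LIMSEQ_prodinf [OF assms] by (simp add: qpoch_inf_def limI)

lemma qpoch_LIMSEQ:
  fixes q :: real
  assumes "0 < q" "q < 1"
  shows "qpoch a q \<longlonglongrightarrow> qpoch_inf a q"
  using qpoch_LIMSEQ_prodinf [OF assms] by (simp add: qpoch_inf_eq_prodinf [OF assms])

lemma qpoch_inf_shift:
  fixes q :: real
  assumes "0 < q" "q < 1"
  shows "qpoch_inf a q = (1 - a) * qpoch_inf (a * q) q"
proof -
  have "(\<lambda>n. qpoch a q (Suc n)) \<longlonglongrightarrow> qpoch_inf a q"
    using qpoch_LIMSEQ [OF assms] by (rule LIMSEQ_Suc)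
  moreover have "(\<lambda>n. qpoch a q (Suc n)) \<longlonglongrightarrow> (1 - a) * qpoch_inf (a * q) q"
    unfolding qpoch_Suc_shift by (intro tendsto_intros qpoch_LIMSEQ assms)
  ultimately show ?thesis
    by (rule LIMSEQ_unique)
qed

lemma qpoch_inf_antimono:
  fixes q :: real
  assumes "0 < q" "q < 1" "a \<le> b" "b \<le> 1"
  shows "qpoch_inf b q \<le> qpoch_inf a q"
proof (rule LIMSEQ_le [OF qpoch_LIMSEQ [OF assms(1,2)] qpoch_LIMSEQ [OF assms(1,2)]])
  have "b * q ^ k \<le> 1" for k
    using assms by (metis mult_le_one power_le_one zero_le_power less_imp_le)
  then have "qpoch b q n \<le> qpoch a q n" for n
    unfolding qpoch_def using assms by (intro prod_mono) (auto intro: mult_right_mono)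
  then show "\<exists>N. \<forall>n\<ge>N. qpoch b q n \<le> qpoch a q n"
    by blast
qed

lemma qpoch_inf_0 [simp]: "qpoch_inf 0 q = 1"
  by (simp add: qpoch_inf_def qpoch_def)

lemma qpoch_inf_pos:
  fixes q :: real
  assumes "0 < q" "q < 1" "0 \<le> a" "a < 1"
  shows "0 < qpoch_inf a q"
proof -
  have pos: "0 < 1 - a * q ^ k" for k
    using assms mult_left_mono [of "q ^ k" 1 a] power_le_one [of q k] by simp
  show ?thesis
    unfolding qpoch_inf_eq_prodinf [OF assms(1,2)]
    using convergent_prod_qpoch [OF assms(1,2)] pos by (rule less_0_prodinf)
qed

section \<open>Recurrence and signs of the reciprocal q-gamma function\<close>

definition qnumber :: "real \<Rightarrow> real \<Rightarrow> real" where
  "qnumber q z = (1 - q powr z) / (1 - q)"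

lemma qnumber_0 [simp]: "q \<noteq> 0 \<Longrightarrow> qnumber q 0 = 0"
  by (simp add: qnumber_def)

lemma qnumber_strict_mono: "0 < q \<Longrightarrow> q < 1 \<Longrightarrow> y < z \<Longrightarrow> qnumber q y < qnumber q z"
  by (simp add: qnumber_def divide_strict_right_mono powr_less_mono')

definition rqGamma :: "real \<Rightarrow> real \<Rightarrow> real" where
  "rqGamma q z = 1 / qGamma q z"

lemma rqGamma_altdef:
  "rqGamma q z = (1 - q) powr (z - 1) * qpoch_inf (q powr z) q / qpoch_inf q q"
  by (simp add: rqGamma_def one_over_qGamma)

lemma rqGamma_rec:
  assumes "0 < q" "q < 1"
  shows "rqGamma q z = qnumber q z * rqGamma q (z + 1)"
proof -
  have "(1 - q) powr z = (1 - q) powr (z - 1) * (1 - q)"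
    using assms powr_add [of "1 - q" "z - 1" 1] by simp
  then show ?thesis
    using assms qpoch_inf_shift [OF assms, of "q powr z"]
    by (simp add: rqGamma_altdef qnumber_def powr_add)
qed

lemma rqGamma_pos:
  assumes "0 < q" "q < 1" "0 < z"
  shows "0 < rqGamma q z"
  using assms powr_less_mono' [of q 0 z] by (simp add: rqGamma_altdef qpoch_inf_pos)

lemma rqGamma_0 [simp]: "0 < q \<Longrightarrow> q < 1 \<Longrightarrow> rqGamma q 0 = 0"
  using rqGamma_rec [of q 0] by simp

lemma rqGamma_nonneg: "0 < q \<Longrightarrow> q < 1 \<Longrightarrow> 0 \<le> z \<Longrightarrow> 0 \<le> rqGamma q z"
  by (cases "z = 0") (auto intro!: less_imp_le [OF rqGamma_pos])

lemma rqGamma_neg: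
  assumes "0 < q" "q < 1" "- 1 < z" "z < 0"
  shows "rqGamma q z < 0"
proof -
  have "qnumber q z < 0"
    using qnumber_strict_mono [of q z 0] assms by simp
  then show ?thesis
    using assms rqGamma_pos [of q "z + 1"] by (subst rqGamma_rec) (auto intro: mult_neg_pos)
qed

lemma rqGamma_minus_one: "0 < q \<Longrightarrow> q < 1 \<Longrightarrow> rqGamma q (- 1) = 0"
  using rqGamma_rec [of q "- 1"] by simp

lemma rqGamma_nonpos: "0 < q \<Longrightarrow> q < 1 \<Longrightarrow> - 1 \<le> z \<Longrightarrow> z \<le> 0 \<Longrightarrow> rqGamma q z \<le> 0"
  using rqGamma_neg [of q z] rqGamma_minus_one [of q] rqGamma_0 [of q]
  by (cases "z = - 1"; cases "z = 0") auto

text \<open>At gap 0 both sides agree. Raising the gap from n to n + 1 divides the left side by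
  \<open>qnumber q (\<mu> + \<beta> + real n)\<close> and the right side by the smaller
  \<open>qnumber q (\<mu> + real n)\<close>.\<close>

lemma rqGamma_cross_pos:
  assumes q: "0 < q" "q < 1" and "0 < \<mu>" "0 < \<beta>"
  shows "rqGamma q \<mu> * rqGamma q (\<mu> + \<beta> + real (Suc n))
    < rqGamma q (\<mu> + real (Suc n)) * rqGamma q (\<mu> + \<beta>)"
proof -
  \<comment> \<open>The weak premise covers both the equality at gap 0 and the strict induction
    hypothesis.\<close>
  have step: "rqGamma q \<mu> * rqGamma q (\<mu> + \<beta> + real (Suc n))
      < rqGamma q (\<mu> + real (Suc n)) * rqGamma q (\<mu> + \<beta>)"
    if le: "rqGamma q \<mu> * rqGamma q (\<mu> + \<beta> + real n) \<le> rqGamma q (\<mu> + real n) * rqGamma q (\<mu> + \<beta>)" for n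
  proof -
    let ?y = "qnumber q (\<mu> + real n)" and ?z = "qnumber q (\<mu> + \<beta> + real n)"
    let ?L = "rqGamma q \<mu> * rqGamma q (\<mu> + \<beta> + real (Suc n))"
    let ?R = "rqGamma q (\<mu> + real (Suc n)) * rqGamma q (\<mu> + \<beta>)"
    have "0 < ?L"
      using assms by (intro mult_pos_pos rqGamma_pos) auto
    moreover have "0 < ?y" "?y < ?z"
      using qnumber_strict_mono [of q 0 "\<mu> + real n"]
        qnumber_strict_mono [of q "\<mu> + real n" "\<mu> + \<beta> + real n"] assms by simp_all
    ultimately have "?y * ?L < ?z * ?L"
      by (metis mult_strict_right_mono)
    also have "\<dots> \<le> ?y * ?R"
      using le rqGamma_rec [OF q, of "\<mu> + real n"] rqGamma_rec [OF q, of "\<mu> + \<beta> + real n"]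
      by (simp add: algebra_simps)
    finally show ?thesis
      using \<open>0 < ?y\<close> by simp
  qed
  show ?thesis
  proof (induction n)
    case 0
    show ?case
      by (rule step) simp
  next
    case (Suc n)
    then show ?case
      by (rule step [OF less_imp_le])
  qed
qed

text \<open>If \<mu> lies in [-1, 0], only \<open>rqGamma q \<mu>\<close> has a nonpositive value;
  the other three arguments are nonnegative, so the two products have opposite weak signs.\<close>

lemma rqGamma_cross_nonneg:
  assumes q: "0 < q" "q < 1" and "- 1 \<le> \<mu>" "- \<beta> \<le> \<mu>" "0 < \<beta>" "0 < n"
  shows "0 \<le> rqGamma q (\<mu> + real n) * rqGamma q (\<mu> + \<beta>)
    - rqGamma q \<mu> * rqGamma q (\<mu> + \<beta> + real n)"
proof (cases "0 < \<mu>")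
  case True
  then show ?thesis
    using rqGamma_cross_pos [OF q, of \<mu> \<beta> "n - 1"] assms by simp
next
  case False
  then have "0 \<le> rqGamma q (\<mu> + real n) * rqGamma q (\<mu> + \<beta>)"
    "rqGamma q \<mu> * rqGamma q (\<mu> + \<beta> + real n) \<le> 0"
    using assms by (auto intro!: mult_nonneg_nonneg mult_nonpos_nonneg rqGamma_nonneg rqGamma_nonpos)
  then show ?thesis
    by linarith
qed

text \<open>At \<mu> = -1 the second product vanishes, and the first one contains
  \<open>rqGamma q 0 = 0\<close> exactly when n = 1 or \<beta> = 1; hence the excluded case.\<close>

lemma rqGamma_cross_strict:
  assumes q: "0 < q" "q < 1" and "- 1 \<le> \<mu>" "- \<beta> \<le> \<mu>" "0 < \<beta>" "0 < n"
    and "\<not> (\<mu> = - 1 \<and> (n = 1 \<or> \<beta> = 1))"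
  shows "0 < rqGamma q (\<mu> + real n) * rqGamma q (\<mu> + \<beta>)
    - rqGamma q \<mu> * rqGamma q (\<mu> + \<beta> + real n)"
proof -
  consider "0 < \<mu>" | "\<mu> = 0 \<or> \<mu> = - 1" | "- 1 < \<mu>" "\<mu> < 0"
    using assms by linarith
  then show ?thesis
  proof cases
    case 1
    then show ?thesis
      using rqGamma_cross_pos [OF q, of \<mu> \<beta> "n - 1"] assms by simp
  next
    case 2
    then have "0 < rqGamma q (\<mu> + real n) * rqGamma q (\<mu> + \<beta>)"
      using assms by (intro mult_pos_pos rqGamma_pos) auto
    moreover have "rqGamma q \<mu> = 0"
      using 2 q by (auto simp: rqGamma_minus_one)
    ultimately show ?thesis
      by simp
  next
    case 3
    then have "0 \<le> rqGamma q (\<mu> + real n) * rqGamma q (\<mu> + \<beta>)"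
      "rqGamma q \<mu> * rqGamma q (\<mu> + \<beta> + real n) < 0"
      using assms by (auto intro!: mult_nonneg_nonneg mult_neg_pos rqGamma_nonneg rqGamma_neg rqGamma_pos)
    then show ?thesis
      by linarith
  qed
qed

section \<open>Doubly positive sequences\<close>

lemma doubly_positive_nonneg: "doubly_positive g \<Longrightarrow> 0 \<le> g n"
  by (simp add: doubly_positive_def)

lemma doubly_positive_pos_between:
  assumes g: "doubly_positive g" and "0 < g i" "0 < g k" "i \<le> j" "j \<le> k"
  shows "0 < g j"
proof (rule ccontr)
  assume "\<not> 0 < g j"
  then have "g j = 0"
    using doubly_positive_nonneg [OF g, of j] by linarith
  then have "(\<forall>i. g (j + i) = 0) \<or> (\<forall>i\<le>j. g (j - i) = 0)"
    using g by (simp add: doubly_positive_def)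
  then show False
  proof
    assume "\<forall>i. g (j + i) = 0"
    from this [rule_format, of "k - j"] show False
      using assms by simp
  next
    assume "\<forall>i\<le>j. g (j - i) = 0"
    from this [rule_format, of "j - i"] show False
      using assms by simp
  qed
qed

lemma doubly_positive_log_concave: "doubly_positive g \<Longrightarrow> g k * g (k + 2) \<le> g (k + 1) * g (k + 1)"
proof -
  assume "doubly_positive g"
  then have "\<forall>k\<ge>1. g (k - 1) * g (k + 1) \<le> (g k)\<^sup>2"
    unfolding doubly_positive_def by blast
  from this [rule_format, of "k + 1"] show ?thesis
    by (simp add: power2_eq_square)
qed

text \<open>Multiply the induction hypothesis by log-concavity at j + 1 and cancel g (j + 1) * g (j
  + 2). The absence of internal zeros makes this factor positive unless the left side is 0.\<close>

lemma doubly_positive_product_mono: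
  assumes g: "doubly_positive g" and "i \<le> j"
  shows "g i * g (j + 2) \<le> g (i + 1) * g (j + 1)"
  using \<open>i \<le> j\<close>
proof (induction j rule: dec_induct)
  case base
  then show ?case
    using doubly_positive_log_concave [OF g] .
next
  case (step j)
  show ?case
  proof (cases "0 < g i \<and> 0 < g (j + 3)")
    case True
    then have pos: "0 < g (j + 1)" "0 < g (j + 2)"
      using doubly_positive_pos_between [OF g, of i "j + 3"] step by auto
    have "(g i * g (j + 3)) * (g (j + 1) * g (j + 2)) = (g i * g (j + 2)) * (g (j + 1) * g (j + 3))"
      by simp
    also have "\<dots> \<le> (g (i + 1) * g (j + 1)) * (g (j + 2) * g (j + 2))"
      using doubly_positive_log_concave [OF g, of "j + 1"]
      by (intro mult_mono [OF step.IH]) (auto simp: doubly_positive_nonneg [OF g] numeral_3_eq_3)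
    also have "\<dots> = (g (i + 1) * g (j + 2)) * (g (j + 1) * g (j + 2))"
      by simp
    finally have "g i * g (j + 3) \<le> g (i + 1) * g (j + 2)"
      using pos by (simp add: mult_le_cancel_right)
    then show ?thesis
      by (simp add: numeral_3_eq_3)
  next
    case False
    then have "g i * g (j + 3) = 0"
      using doubly_positive_nonneg [OF g, of i] doubly_positive_nonneg [OF g, of "j + 3"] by force
    then show ?thesis
      using doubly_positive_nonneg [OF g] by (auto simp: numeral_3_eq_3)
  qed
qed

text \<open>From the first nonzero entry on, log-concavity bounds every quotient of neighbours by
  the first quotient.\<close>

lemma doubly_positive_geometric_bound:
  assumes g: "doubly_positive g"
  obtains C r where "0 < C" "0 < r" "\<And>n. g n \<le> C * r ^ n"
proof -
  define N where "N = (LEAST n. g n \<noteq> 0)"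
  have "\<exists>n. g n \<noteq> 0"
    using g unfolding doubly_positive_def by blast
  then have "g N \<noteq> 0"
    unfolding N_def by (rule LeastI_ex)
  then have N: "0 < g N"
    using doubly_positive_nonneg [OF g, of N] by linarith
  have below: "g n = 0" if "n < N" for n
    using not_less_Least that unfolding N_def by blast
  \<comment> \<open>The summand 1 gives r \<ge> 1, so that r ^ (n - N) can be enlarged to r ^ n
    below.\<close>
  define r where "r = g (N + 1) / g N + 1"
  have r: "1 \<le> r"
    using N doubly_positive_nonneg [OF g] by (simp add: r_def)
  have step: "g (N + i + 1) \<le> r * g (N + i)" for i
  proof -
    have "g N * g (N + i + 1) \<le> g (N + 1) * g (N + i)"
    proof (cases i)
      case (Suc j)
      then show ?thesis
        using doubly_positive_product_mono [OF g, of N "N + j"] by simp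
    qed simp
    then have "g (N + i + 1) \<le> g (N + 1) / g N * g (N + i)"
      using N by (simp add: field_simps)
    also have "\<dots> \<le> r * g (N + i)"
      by (intro mult_right_mono) (simp_all add: r_def doubly_positive_nonneg [OF g])
    finally show ?thesis .
  qed
  have bound: "g (N + i) \<le> g N * r ^ i" for i
  proof (induction i)
    case (Suc i)
    have "g (N + Suc i) \<le> r * g (N + i)"
      using step [of i] by simp
    also have "\<dots> \<le> r * (g N * r ^ i)"
      using Suc r by (intro mult_left_mono) auto
    finally show ?case
      by (simp add: mult_ac)
  qed simp
  have "g n \<le> g N * r ^ n" for n
  proof (cases "n < N")
    case True
    then show ?thesis
      using N r by (simp add: below)
  next
    case False
    then have "g n \<le> g N * r ^ (n - N)"
      using bound [of "n - N"] by simp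
    also have "\<dots> \<le> g N * r ^ n"
      using N r by (intro mult_left_mono power_increasing) auto
    finally show ?thesis .
  qed
  then show thesis
    using that [of "g N" r] N r by simp
qed

section \<open>The coefficients of the Turanian\<close>

text \<open>With v the increments of w, symmetry gives w k as the sum of v j over j \<le> min k (m -
  k). After swapping the sums, j collects the differences of u over j \<le> k \<le> m - j, which
  telescope; this range is empty unless 2 * j \<le> m.\<close>

lemma sum_symmetric_abel:
  fixes w u :: "nat \<Rightarrow> real"
  assumes sym: "\<And>k. k \<le> m \<Longrightarrow> w (m - k) = w k"
  shows "(\<Sum>k\<le>m. w k * (u (Suc k) - u k))
    = (\<Sum>j | 2 * j \<le> m. (w j - (if j = 0 then 0 else w (j - 1))) * (u (m + 1 - j) - u j))"
proof -
  define v where "v j = w j - (if j = 0 then 0 else w (j - 1))" for j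
  have sum_v: "sum v {..n} = w n" for n
    by (induction n) (simp_all add: v_def)
  have w_eq: "w k = (\<Sum>j\<le>m. if j \<le> k \<and> j \<le> m - k then v j else 0)" if "k \<le> m" for k
  proof -
    have "w k = w (min k (m - k))"
      using sym [OF that] by (simp add: min_def)
    also have "\<dots> = sum v {..min k (m - k)}"
      by (simp add: sum_v)
    also have "\<dots> = (\<Sum>j\<le>m. if j \<le> k \<and> j \<le> m - k then v j else 0)"
      using that by (intro sum.mono_neutral_cong_left) auto
    finally show ?thesis .
  qed
  have inner: "(\<Sum>k\<le>m. (if j \<le> k \<and> j \<le> m - k then v j else 0) * (u (Suc k) - u k))
      = (if 2 * j \<le> m then v j * (u (m + 1 - j) - u j) else 0)" if "j \<le> m" for j
  proof -
    have "(\<Sum>k\<le>m. (if j \<le> k \<and> j \<le> m - k then v j else 0) * (u (Suc k) - u k))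
        = (\<Sum>k\<in>{j..<m + 1 - j}. v j * (u (Suc k) - u k))"
      by (rule sum.mono_neutral_cong_right) auto
    also have "\<dots> = v j * (\<Sum>k\<in>{j..<m + 1 - j}. u (Suc k) - u k)"
      by (simp add: sum_distrib_left)
    also have "\<dots> = (if 2 * j \<le> m then v j * (u (m + 1 - j) - u j) else 0)"
      by (simp add: sum_Suc_diff')
    finally show ?thesis .
  qed
  have "(\<Sum>k\<le>m. w k * (u (Suc k) - u k))
      = (\<Sum>k\<le>m. \<Sum>j\<le>m. (if j \<le> k \<and> j \<le> m - k then v j else 0) * (u (Suc k) - u k))"
    by (intro sum.cong refl) (simp add: w_eq sum_distrib_right)
  also have "\<dots> = (\<Sum>j\<le>m. \<Sum>k\<le>m. (if j \<le> k \<and> j \<le> m - k then v j else 0) * (u (Suc k) - u k))"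
    by (rule sum.swap)
  also have "\<dots> = (\<Sum>j\<le>m. if 2 * j \<le> m then v j * (u (m + 1 - j) - u j) else 0)"
    by (intro sum.cong refl) (simp add: inner)
  also have "\<dots> = (\<Sum>j | 2 * j \<le> m. v j * (u (m + 1 - j) - u j))"
    by (intro sum.mono_neutral_cong_right) auto
  finally show ?thesis
    by (simp add: v_def)
qed

section \<open>Cauchy product coefficients of the Turanian and their signs\<close>

definition turan_coeff :: "real \<Rightarrow> (nat \<Rightarrow> real) \<Rightarrow> real \<Rightarrow> real \<Rightarrow> real \<Rightarrow> nat \<Rightarrow> real" where
  "turan_coeff q g \<mu> \<alpha> \<beta> m =
    (\<Sum>k\<le>m. g k * g (m - k) *
      (rqGamma q (\<mu> + \<alpha> + real k) * rqGamma q (\<mu> + \<beta> + real (m - k))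
       - rqGamma q (\<mu> + real k) * rqGamma q (\<mu> + \<alpha> + \<beta> + real (m - k))))"

lemma turan_coeff_telescope:
  "turan_coeff q g \<mu> (real \<alpha>) \<beta> m =
    (\<Sum>j<\<alpha>. turan_coeff q g (\<mu> + real j) 1 (\<beta> + real \<alpha> - 1 - 2 * real j) m)"
proof -
  \<comment> \<open>F j is the m-th coefficient of g(\<mu> + j; x) g(\<mu> + \<alpha> + \<beta> - j;
    x): each step shifts one unit between the parameters and keeps their sum.\<close>
  define F where "F j = (\<Sum>k\<le>m. g k * g (m - k) *
      (rqGamma q (\<mu> + real j + real k) * rqGamma q (\<mu> + real \<alpha> + \<beta> - real j + real (m - k))))" for j
  have "turan_coeff q g (\<mu> + real j) 1 (\<beta> + real \<alpha> - 1 - 2 * real j) m = F (Suc j) - F j" for j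
    unfolding turan_coeff_def F_def sum_subtractf [symmetric]
    by (intro sum.cong refl) (simp add: algebra_simps)
  then have "(\<Sum>j<\<alpha>. turan_coeff q g (\<mu> + real j) 1 (\<beta> + real \<alpha> - 1 - 2 * real j) m) = F \<alpha> - F 0"
    by (simp add: sum_lessThan_telescope)
  also have "\<dots> = turan_coeff q g \<mu> (real \<alpha>) \<beta> m"
    unfolding turan_coeff_def F_def sum_subtractf [symmetric]
    by (intro sum.cong refl) (simp add: algebra_simps)
  finally show ?thesis
    by simp
qed

text \<open>The Abel-summed form, arranged so that each second factor is a cross difference with
  base \<mu> + j and gap m + 1 - 2 * j, as in \<open>rqGamma_cross_nonneg\<close>.\<close>

lemma turan_coeff_one:
  "turan_coeff q g \<mu> 1 \<beta> m =
    (\<Sum>j | 2 * j \<le> m. (g j * g (m - j) - (if j = 0 then 0 else g (j - 1) * g (m - (j - 1)))) *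
      (rqGamma q (\<mu> + real j + real (m + 1 - 2 * j)) * rqGamma q (\<mu> + real j + \<beta>)
       - rqGamma q (\<mu> + real j) * rqGamma q (\<mu> + real j + \<beta> + real (m + 1 - 2 * j))))"
proof -
  define u where "u k = rqGamma q (\<mu> + real k) * rqGamma q (\<mu> + \<beta> + real (m + 1) - real k)" for k
  have "turan_coeff q g \<mu> 1 \<beta> m = (\<Sum>k\<le>m. g k * g (m - k) * (u (Suc k) - u k))"
    unfolding turan_coeff_def u_def
    by (intro sum.cong refl) (simp add: algebra_simps of_nat_diff)
  also have "\<dots> = (\<Sum>j | 2 * j \<le> m. (g j * g (m - j) - (if j = 0 then 0 else g (j - 1) * g (m - (j - 1))))
      * (u (m + 1 - j) - u j))"
    by (rule sum_symmetric_abel) simp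
  finally show ?thesis
    by (simp add: u_def of_nat_diff algebra_simps)
qed

lemma doubly_positive_product_diff_nonneg:
  assumes "doubly_positive g" "2 * j \<le> m"
  shows "0 \<le> g j * g (m - j) - (if j = 0 then 0 else g (j - 1) * g (m - (j - 1)))"
proof (cases j)
  case 0
  then show ?thesis
    by (simp add: doubly_positive_nonneg [OF assms(1)])
next
  case (Suc i)
  then have "m - j - 1 + 2 = m - i" "m - j - 1 + 1 = m - j"
    using assms(2) by auto
  then show ?thesis
    using doubly_positive_product_mono [OF assms(1), of i "m - j - 1"] Suc assms(2) by simp
qed

lemma turan_coeff_one_nonneg:
  assumes "0 < q" "q < 1" "doubly_positive g" "- 1 \<le> \<mu>" "- \<beta> \<le> \<mu>" "0 < \<beta>"
  shows "0 \<le> turan_coeff q g \<mu> 1 \<beta> m"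
  unfolding turan_coeff_one
  using assms
  by (intro sum_nonneg mult_nonneg_nonneg rqGamma_cross_nonneg doubly_positive_product_diff_nonneg) auto

text \<open>A single nonzero increment v j with a strict cross difference suffices. For \<mu> = -1
  only j = 0 can lose strictness, namely if m = 0 or \<beta> = 1. For \<beta> = 1 an increment with
  j > 0 is required, and one exists once the weights are not constant.\<close>

lemma turan_coeff_one_pos:
  assumes q: "0 < q" "q < 1" and g: "doubly_positive g" and \<mu>: "- 1 \<le> \<mu>" "- \<beta> \<le> \<mu>" "0 < \<beta>"
    and k: "k \<le> m" "g k * g (m - k) \<noteq> 0"
    and "\<not> (\<mu> = - 1 \<and> m = 0)"
    and "\<not> (\<mu> = - 1 \<and> \<beta> = 1 \<and> (\<forall>k\<le>m. g k * g (m - k) = g 0 * g m))"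
  shows "0 < turan_coeff q g \<mu> 1 \<beta> m"
proof -
  define w where "w j = g j * g (m - j)" for j
  define v where "v j = w j - (if j = 0 then 0 else w (j - 1))" for j
  have sum_v: "sum v {..n} = w n" for n
    by (induction n) (simp_all add: v_def)
  have w_min: "w i = w (min i (m - i))" if "i \<le> m" for i
    using that by (simp add: w_def min_def)
  have v_nonneg: "0 \<le> v j" if "2 * j \<le> m" for j
    using doubly_positive_product_diff_nonneg [OF g that] unfolding v_def w_def .
  obtain j where j: "2 * j \<le> m" "v j \<noteq> 0" "\<not> (\<mu> = - 1 \<and> \<beta> = 1 \<and> j = 0)"
  proof (cases "\<mu> = - 1 \<and> \<beta> = 1")
    case True
    then obtain i where i: "i \<le> m" "w i \<noteq> w 0"
      using assms by (auto simp: w_def)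
    define i' where "i' = min i (m - i)"
    have "sum v {..i'} \<noteq> v 0"
      using i w_min [of i] unfolding sum_v i'_def by (simp add: v_def)
    then have "sum v ({..i'} - {0}) \<noteq> 0"
      by (simp add: sum_diff1)
    then obtain j where "j \<in> {..i'} - {0}" "v j \<noteq> 0"
      by (meson sum.neutral)
    then show thesis
      using i by (intro that [of j]) (auto simp: i'_def)
  next
    case False
    define i' where "i' = min k (m - k)"
    have "w k \<noteq> 0"
      using k by (simp add: w_def)
    then have "sum v {..i'} \<noteq> 0"
      using w_min [OF k(1)] unfolding sum_v i'_def by simp
    then obtain j where "j \<in> {..i'}" "v j \<noteq> 0"
      by (meson sum.neutral)
    then show thesis
      using k False by (intro that [of j]) (auto simp: i'_def)
  qed
  have v_eq: "v i = g i * g (m - i) - (if i = 0 then 0 else g (i - 1) * g (m - (i - 1)))" for i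
    by (simp add: v_def w_def)
  show ?thesis
    unfolding turan_coeff_one v_eq [symmetric]
  proof (rule sum_pos2)
    show "finite {j. 2 * j \<le> m}"
      by (rule finite_subset [of _ "{..m}"]) auto
    show "j \<in> {j. 2 * j \<le> m}"
      using j by simp
    show "0 < v j *
      (rqGamma q (\<mu> + real j + real (m + 1 - 2 * j)) * rqGamma q (\<mu> + real j + \<beta>)
       - rqGamma q (\<mu> + real j) * rqGamma q (\<mu> + real j + \<beta> + real (m + 1 - 2 * j)))"
      using q \<mu> j v_nonneg [of j] assms(9)
      by (intro mult_pos_pos rqGamma_cross_strict) auto
    show "0 \<le> v i *
      (rqGamma q (\<mu> + real i + real (m + 1 - 2 * i)) * rqGamma q (\<mu> + real i + \<beta>)
       - rqGamma q (\<mu> + real i) * rqGamma q (\<mu> + real i + \<beta> + real (m + 1 - 2 * i)))"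
      if "i \<in> {j. 2 * j \<le> m}" for i
      using q \<mu> that v_nonneg [of i]
      by (intro mult_nonneg_nonneg rqGamma_cross_nonneg) auto
  qed
qed

text \<open>Reversing the summation exchanges the two products. Parameter 0 occurs in the
  telescoping sum for \<alpha> = \<beta> + 1, at its last index j = \<alpha> - 1.\<close>

lemma turan_coeff_one_0: "turan_coeff q g \<mu> 1 0 m = 0"
proof -
  have "(\<Sum>k\<le>m. g k * g (m - k) * (rqGamma q (\<mu> + 1 + real k) * rqGamma q (\<mu> + real (m - k))))
    = (\<Sum>k\<le>m. g k * g (m - k) * (rqGamma q (\<mu> + real k) * rqGamma q (\<mu> + 1 + real (m - k))))"
    by (rule sum.reindex_bij_witness [where i = "\<lambda>k. m - k" and j = "\<lambda>k. m - k"]) auto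
  then show ?thesis
    by (simp add: turan_coeff_def sum_subtractf right_diff_distrib)
qed

lemma turan_coeff_summand_nonneg:
  assumes "0 < q" "q < 1" "doubly_positive g" "- 1 \<le> \<mu>" "- \<beta> \<le> \<mu>" "0 < \<beta>"
    and "real \<alpha> \<le> \<beta> + 1" "j < \<alpha>"
  shows "0 \<le> turan_coeff q g (\<mu> + real j) 1 (\<beta> + real \<alpha> - 1 - 2 * real j) m"
proof -
  have "real j + 1 \<le> real \<alpha>"
    using assms by linarith
  then show ?thesis
    using assms turan_coeff_one_0
    by (cases "\<beta> + real \<alpha> - 1 - 2 * real j = 0") (auto intro!: turan_coeff_one_nonneg)
qed

lemma turan_coeff_nonneg:
  assumes "0 < q" "q < 1" "doubly_positive g" "- 1 \<le> \<mu>" "- \<beta> \<le> \<mu>" "0 < \<beta>"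
    and "real \<alpha> \<le> \<beta> + 1"
  shows "0 \<le> turan_coeff q g \<mu> (real \<alpha>) \<beta> m"
  unfolding turan_coeff_telescope using assms by (intro sum_nonneg turan_coeff_summand_nonneg) auto

lemma turan_coeff_pos:
  assumes q: "0 < q" "q < 1" and g: "doubly_positive g" and \<mu>: "- 1 \<le> \<mu>" "- \<beta> \<le> \<mu>" "0 < \<beta>"
    and \<alpha>: "1 \<le> \<alpha>" "real \<alpha> \<le> \<beta> + 1"
    and k: "k \<le> m" "g k * g (m - k) \<noteq> 0"
    and ex1: "\<not> (\<mu> = - 1 \<and> m = 0 \<and> (\<alpha> = 1 \<or> \<beta> = 1))"
    and ex2: "\<not> (\<mu> = - 1 \<and> \<alpha> = 1 \<and> \<beta> = 1 \<and> (\<forall>k\<le>m. g k * g (m - k) = g 0 * g m))"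
  shows "0 < turan_coeff q g \<mu> (real \<alpha>) \<beta> m"
proof -
  obtain j where j: "j < \<alpha>" "0 < turan_coeff q g (\<mu> + real j) 1 (\<beta> + real \<alpha> - 1 - 2 * real j) m"
  proof (cases "\<mu> = - 1 \<and> m = 0")
    case True
    then have *: "2 \<le> \<alpha>" "1 < \<beta>"
      using ex1 \<mu> \<alpha> by auto
    then have "2 \<le> real \<alpha>"
      by simp
    \<comment> \<open>For \<mu> = -1 and m = 0 the summand j = 0 vanishes, so positivity comes from
      j = 1, whose base is 0.\<close>
    have "0 < turan_coeff q g (\<mu> + real 1) 1 (\<beta> + real \<alpha> - 1 - 2 * real 1) m"
      using True * \<open>2 \<le> real \<alpha>\<close> k by (intro turan_coeff_one_pos [where k = k] q g) auto
    then show thesis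
      using * by (intro that [of 1]) auto
  next
    case False
    \<comment> \<open>Since \<mu> = -1 forces \<beta> \<ge> 1, the exceptional parameter 1 of the
      summand j = 0 can only come from \<alpha> = \<beta> = 1, which \<open>ex2\<close>
      handles.\<close>
    have "\<beta> + real \<alpha> - 1 = 1 \<Longrightarrow> \<mu> = - 1 \<Longrightarrow> \<alpha> = 1 \<and> \<beta> = 1"
      using \<mu> \<alpha> by auto
    then have "0 < turan_coeff q g (\<mu> + real 0) 1 (\<beta> + real \<alpha> - 1 - 2 * real 0) m"
      using \<mu> \<alpha> k ex2 False by (intro turan_coeff_one_pos [where k = k] q g) auto
    then show thesis
      using \<alpha> by (intro that [of 0]) auto
  qed
  show ?thesis
    unfolding turan_coeff_telescope
    using j q g \<mu> \<alpha> by (intro sum_pos2 [where i = j] turan_coeff_summand_nonneg) auto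
qed

section \<open>Convergence\<close>

lemma conv_radius_le_of_bounded:
  fixes a b :: "nat \<Rightarrow> real"
  assumes "eventually (\<lambda>n. \<bar>a n\<bar> \<le> C * \<bar>b n\<bar>) sequentially"
  shows "conv_radius b \<le> conv_radius a"
proof (rule conv_radius_geI_ex')
  fix r :: real
  assume r: "0 < r" "ereal r < conv_radius b"
  then have "summable (\<lambda>n. norm (b n * r ^ n))"
    by (intro abs_summable_in_conv_radius) simp
  then have "summable (\<lambda>n. C * norm (b n * r ^ n))"
    by (rule summable_mult)
  moreover have "eventually (\<lambda>n. norm (a n * r ^ n) \<le> C * norm (b n * r ^ n)) sequentially"
    using assms
  proof eventually_elim
    case (elim n)
    then show ?case
      using r mult_right_mono [OF elim, of "r ^ n"] by (simp add: abs_mult)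
  qed
  ultimately show "summable (\<lambda>n. a n * of_real r ^ n)"
    using summable_comparison_test_ev [of "\<lambda>n. a n * r ^ n"] by simp
qed

lemma qseries_coeff_eq: "qseries_coeff q g \<nu> n = g n * rqGamma q (\<nu> + real n)"
  by (simp add: qseries_coeff_def rqGamma_def)

lemma turan_coeff_sums:
  assumes conv: "\<And>\<nu>. ereal \<bar>x\<bar> < conv_radius (qseries_coeff q g \<nu>)"
  shows "(\<lambda>m. turan_coeff q g \<mu> \<alpha> \<beta> m * x ^ m) sums gen_turanian q g \<mu> \<alpha> \<beta> x"
proof -
  have summable: "summable (\<lambda>n. norm (qseries_coeff q g \<nu> n * x ^ n))" for \<nu>
    using conv [of \<nu>] by (intro abs_summable_in_conv_radius) simp
  have power: "x ^ k * x ^ (m - k) = x ^ m" if "k \<le> m" for k m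
    using that by (simp flip: power_add)
  have "(\<lambda>m. (\<Sum>k\<le>m. qseries_coeff q g (\<mu> + \<alpha>) k * x ^ k * (qseries_coeff q g (\<mu> + \<beta>) (m - k) * x ^ (m - k)))
      - (\<Sum>k\<le>m. qseries_coeff q g \<mu> k * x ^ k * (qseries_coeff q g (\<mu> + \<alpha> + \<beta>) (m - k) * x ^ (m - k))))
    sums gen_turanian q g \<mu> \<alpha> \<beta> x"
    unfolding gen_turanian_def qseries_def
    by (intro sums_diff Cauchy_product_sums summable)
  moreover have "(\<Sum>k\<le>m. qseries_coeff q g (\<mu> + \<alpha>) k * x ^ k * (qseries_coeff q g (\<mu> + \<beta>) (m - k) * x ^ (m - k)))
      - (\<Sum>k\<le>m. qseries_coeff q g \<mu> k * x ^ k * (qseries_coeff q g (\<mu> + \<alpha> + \<beta>) (m - k) * x ^ (m - k)))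
      = turan_coeff q g \<mu> \<alpha> \<beta> m * x ^ m" for m
    unfolding turan_coeff_def sum_subtractf [symmetric] sum_distrib_right
  proof (intro sum.cong refl)
    fix k assume "k \<in> {..m}"
    then have "x ^ m = x ^ k * x ^ (m - k)"
      by (simp add: power)
    then show "qseries_coeff q g (\<mu> + \<alpha>) k * x ^ k * (qseries_coeff q g (\<mu> + \<beta>) (m - k) * x ^ (m - k))
      - qseries_coeff q g \<mu> k * x ^ k * (qseries_coeff q g (\<mu> + \<alpha> + \<beta>) (m - k) * x ^ (m - k))
      = g k * g (m - k) * (rqGamma q (\<mu> + \<alpha> + real k) * rqGamma q (\<mu> + \<beta> + real (m - k))
       - rqGamma q (\<mu> + real k) * rqGamma q (\<mu> + \<alpha> + \<beta> + real (m - k))) * x ^ m"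
      unfolding qseries_coeff_eq by (simp add: algebra_simps)
  qed
  ultimately show ?thesis
    by simp
qed

text \<open>For z \<ge> 1 the argument q powr z lies in [0, q], so its infinite product lies between
  \<open>qpoch_inf q q\<close> and 1.\<close>

lemma rqGamma_bounds:
  assumes "0 < q" "q < 1" "1 \<le> z"
  shows "(1 - q) powr (z - 1) \<le> rqGamma q z"
    and "rqGamma q z \<le> (1 - q) powr (z - 1) / qpoch_inf q q"
proof -
  have *: "0 < qpoch_inf q q" "q powr z \<le> q"
    using assms qpoch_inf_pos [of q q] powr_mono' [of 1 z q] by auto
  have "qpoch_inf q q \<le> qpoch_inf (q powr z) q" "qpoch_inf (q powr z) q \<le> qpoch_inf 0 q"
    using assms * by (intro qpoch_inf_antimono; simp)+
  then show "(1 - q) powr (z - 1) \<le> rqGamma q z" "rqGamma q z \<le> (1 - q) powr (z - 1) / qpoch_inf q q"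
    using * assms by (auto simp: rqGamma_altdef field_simps intro: mult_left_mono)
qed

text \<open>For large n, \<open>rqGamma q (\<nu> + real n)\<close> equals (1 - q) ^ n up to factors
  bounded above and away from 0. The radius therefore does not depend on \<nu>.\<close>

lemma conv_radius_qseries_coeff:
  assumes q: "0 < q" "q < 1"
  shows "conv_radius (qseries_coeff q g \<nu>) = conv_radius (\<lambda>n. g n * (1 - q) ^ n)"
proof (rule antisym)
  define K where "K = (1 - q) powr (\<nu> - 1)"
  have K: "0 < K" "K * (1 - q) ^ n = (1 - q) powr (\<nu> + real n - 1)" for n
    using q by (auto simp: K_def powr_realpow simp flip: powr_add) (simp add: algebra_simps flip: powr_realpow powr_add)
  have ev: "eventually (\<lambda>n. 1 \<le> \<nu> + real n) sequentially"
    by real_asymp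
  show "conv_radius (qseries_coeff q g \<nu>) \<le> conv_radius (\<lambda>n. g n * (1 - q) ^ n)"
  proof (rule conv_radius_le_of_bounded)
    show "\<forall>\<^sub>F n in sequentially. \<bar>g n * (1 - q) ^ n\<bar> \<le> 1 / K * \<bar>qseries_coeff q g \<nu> n\<bar>"
      using ev
    proof eventually_elim
      case (elim n)
      then have "K * (1 - q) ^ n \<le> \<bar>rqGamma q (\<nu> + real n)\<bar>"
        using rqGamma_bounds(1) [OF q elim] K(2) [of n] by linarith
      then have "\<bar>g n\<bar> * (K * (1 - q) ^ n) \<le> \<bar>g n\<bar> * \<bar>rqGamma q (\<nu> + real n)\<bar>"
        by (intro mult_left_mono) auto
      then show ?case
        using K(1) q by (simp add: qseries_coeff_eq abs_mult field_simps)
    qed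
  qed
  show "conv_radius (\<lambda>n. g n * (1 - q) ^ n) \<le> conv_radius (qseries_coeff q g \<nu>)"
  proof (rule conv_radius_le_of_bounded)
    show "\<forall>\<^sub>F n in sequentially. \<bar>qseries_coeff q g \<nu> n\<bar> \<le> K / qpoch_inf q q * \<bar>g n * (1 - q) ^ n\<bar>"
      using ev
    proof eventually_elim
      case (elim n)
      then have "\<bar>rqGamma q (\<nu> + real n)\<bar> \<le> K * (1 - q) ^ n / qpoch_inf q q"
        using rqGamma_bounds(2) [OF q elim] rqGamma_nonneg [of q "\<nu> + real n"] q K(2) [of n] by simp
      then have "\<bar>g n\<bar> * \<bar>rqGamma q (\<nu> + real n)\<bar> \<le> \<bar>g n\<bar> * (K * (1 - q) ^ n / qpoch_inf q q)"
        by (intro mult_left_mono) auto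
      then show ?case
        using q by (simp add: qseries_coeff_eq abs_mult mult_ac)
    qed
  qed
qed

lemma conv_radius_qseries_coeff_pos:
  assumes q: "0 < q" "q < 1" and g: "doubly_positive g"
  shows "0 < conv_radius (\<lambda>n. g n * (1 - q) ^ n)"
proof -
  obtain C r where C: "0 < C" "0 < r" "\<And>n. g n \<le> C * r ^ n"
    using doubly_positive_geometric_bound [OF g] by blast
  \<comment> \<open>At the point 1 / r the growth r ^ n cancels and leaves the geometric series in 1
    - q.\<close>
  have "summable (\<lambda>n. g n * (1 - q) ^ n * (1 / r) ^ n)"
  proof (rule summable_comparison_test')
    show "summable (\<lambda>n. C * (1 - q) ^ n)"
      using q by (intro summable_mult summable_geometric) auto
    fix n
    have "g n * (1 - q) ^ n * (1 / r) ^ n \<le> C * r ^ n * (1 - q) ^ n * (1 / r) ^ n"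
      using q C by (intro mult_right_mono) auto
    then show "norm (g n * (1 - q) ^ n * (1 / r) ^ n) \<le> C * (1 - q) ^ n"
      using q C doubly_positive_nonneg [OF g, of n] by (simp add: abs_mult power_divide)
  qed
  then have "ereal (norm (1 / r)) \<le> conv_radius (\<lambda>n. g n * (1 - q) ^ n)"
    by (rule conv_radius_geI)
  moreover have "0 < ereal (norm (1 / r))"
    using C by simp
  ultimately show ?thesis
    by (rule less_le_trans [rotated])
qed

section \<open>Positivity of the Turanian\<close>

lemma qseries_nonneg:
  assumes "0 < q" "q < 1" "doubly_positive g" "0 \<le> \<nu>" "0 < x"
    and "ereal x < conv_radius (qseries_coeff q g \<nu>)"
  shows "0 \<le> qseries q g \<nu> x"
  unfolding qseries_def using assms
  by (intro suminf_nonneg summable_in_conv_radius)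
    (auto simp: qseries_coeff_eq intro!: mult_nonneg_nonneg rqGamma_nonneg
      intro: doubly_positive_nonneg)

text \<open>At \<nu> = 0 the constant term is lost because \<open>rqGamma q 0 = 0\<close>, so a
  nonzero entry of positive index is required there.\<close>

lemma qseries_pos:
  assumes "0 < q" "q < 1" "doubly_positive g" "0 \<le> \<nu>" "0 < x"
    and "ereal x < conv_radius (qseries_coeff q g \<nu>)"
    and "\<not> (\<nu> = 0 \<and> (\<forall>n\<ge>1. g n = 0))"
  shows "0 < qseries q g \<nu> x"
proof -
  obtain n where n: "g n \<noteq> 0" "\<nu> \<noteq> 0 \<or> 1 \<le> n"
    using assms by (auto simp: doubly_positive_def)
  then have "0 < g n"
    using doubly_positive_nonneg [OF assms(3), of n] by simp
  then have "0 < qseries_coeff q g \<nu> n * x ^ n"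
    using n assms by (auto simp: qseries_coeff_eq intro!: mult_pos_pos rqGamma_pos)
  moreover have "0 \<le> qseries_coeff q g \<nu> i * x ^ i" for i
    using assms by (auto simp: qseries_coeff_eq intro!: mult_nonneg_nonneg rqGamma_nonneg
      intro: doubly_positive_nonneg)
  moreover have "summable (\<lambda>n. qseries_coeff q g \<nu> n * x ^ n)"
    using assms by (intro summable_in_conv_radius) auto
  ultimately show ?thesis
    unfolding qseries_def by (intro suminf_pos2)
qed

lemma gen_turanian_one_nonneg:
  assumes "0 < q" "q < 1" "doubly_positive g" "- 1 \<le> \<mu>" "- \<beta> \<le> \<mu>" "0 < \<beta>" "0 < x"
    and "\<And>\<nu>. ereal \<bar>x\<bar> < conv_radius (qseries_coeff q g \<nu>)"
  shows "0 \<le> gen_turanian q g \<mu> 1 \<beta> x"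
proof (rule sums_le [OF _ sums_zero turan_coeff_sums])
  show "0 \<le> turan_coeff q g \<mu> 1 \<beta> n * x ^ n" for n
    using assms by (intro mult_nonneg_nonneg turan_coeff_one_nonneg) auto
qed (use assms in auto)

lemma gen_turanian_one_pos:
  assumes q: "0 < q" "q < 1" and g: "doubly_positive g" and \<mu>: "- 1 \<le> \<mu>" "- \<beta> \<le> \<mu>" "0 < \<beta>"
    and x: "0 < x" "\<And>\<nu>. ereal \<bar>x\<bar> < conv_radius (qseries_coeff q g \<nu>)"
    and ex1: "\<not> (\<mu> = - 1 \<and> (\<forall>n\<ge>1. g n = 0))"
    and ex2: "\<not> (\<mu> = - 1 \<and> \<beta> = 1 \<and> (\<exists>r. \<forall>n. g n = g 0 * r ^ n))"
  shows "0 < gen_turanian q g \<mu> 1 \<beta> x"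
proof -
  obtain m where m: "0 < turan_coeff q g \<mu> 1 \<beta> m"
  proof (cases "\<mu> = - 1 \<and> \<beta> = 1")
    case True
    \<comment> \<open>Otherwise all weights of equal index sum agree, which forces g to be
      geometric, against \<open>ex2\<close>.\<close>
    have "\<exists>i j. g i * g j \<noteq> g 0 * g (i + j)"
    proof (rule ccontr)
      assume "\<not> (\<exists>i j. g i * g j \<noteq> g 0 * g (i + j))"
      then have eq: "g i * g j = g 0 * g (i + j)" for i j
        by blast
      show False
      proof (cases "g 0 = 0")
        case True
        then have "g i = 0" for i
          using eq [of i i] by simp
        then show False
          using g by (auto simp: doubly_positive_def)
      next
        case False
        have "g n = g 0 * (g 1 / g 0) ^ n" for n
        proof (induction n)
          case (Suc n)
          have "g (Suc n) = g 1 / g 0 * g n"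
            using eq [of 1 n] False by (simp add: field_simps)
          then show ?case
            using Suc by simp
        qed simp
        then show False
          using ex2 True by blast
      qed
    qed
    then obtain i j where ij: "g i * g j \<noteq> g 0 * g (i + j)"
      by blast
    have ne: "i + j \<noteq> 0"
      using ij by (intro notI) simp
    have w: "\<exists>k\<le>i + j. g k * g (i + j - k) \<noteq> 0"
    proof (cases "g i * g j = 0")
      case True
      then show ?thesis
        using ij by (intro exI [of _ 0]) auto
    next
      case False
      then show ?thesis
        by (intro exI [of _ i]) auto
    qed
    then obtain k where "k \<le> i + j" "g k * g (i + j - k) \<noteq> 0"
      by blast
    moreover have "\<not> (\<forall>k\<le>i + j. g k * g (i + j - k) = g 0 * g (i + j))"
      using ij by (auto intro!: exI [of _ i])
    ultimately have "0 < turan_coeff q g \<mu> 1 \<beta> (i + j)"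
      using ne by (intro turan_coeff_one_pos [where k = k] q g \<mu>) auto
    then show thesis
      by (rule that)
  next
    case False
    obtain n where n: "g n \<noteq> 0" "\<mu> = - 1 \<longrightarrow> 1 \<le> n"
      using ex1 g by (cases "\<mu> = - 1") (auto simp: doubly_positive_def)
    \<comment> \<open>The even index 2 * n has the nonzero central weight g n * g n; for \<mu> = -1,
      n \<ge> 1 avoids the vanishing coefficient at 0.\<close>
    then have "0 < turan_coeff q g \<mu> 1 \<beta> (2 * n)"
      using False by (intro turan_coeff_one_pos [where k = n] q g \<mu>) auto
    then show thesis
      by (rule that)
  qed
  have sums: "(\<lambda>m. turan_coeff q g \<mu> 1 \<beta> m * x ^ m) sums gen_turanian q g \<mu> 1 \<beta> x"
    using x by (intro turan_coeff_sums)
  have "0 < (\<Sum>m. turan_coeff q g \<mu> 1 \<beta> m * x ^ m)"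
    using m x q g \<mu>
    by (intro suminf_pos2 [where i = m] sums_summable [OF sums] mult_nonneg_nonneg turan_coeff_one_nonneg) auto
  then show ?thesis
    using sums_unique [OF sums] by simp
qed

text \<open>Induction on \<alpha> with a division-free form of the product of quotients, since
  g(\<mu>; x) need not be positive. Nonnegativity is carried along because the induction step uses
  it also where strictness fails.\<close>

lemma gen_turanian_nonneg_and_pos:
  assumes q: "0 < q" "q < 1" and g: "doubly_positive g" and \<mu>: "- 1 \<le> \<mu>" "- \<beta> \<le> \<mu>" "0 < \<beta>"
    and x: "0 < x" "\<And>\<nu>. ereal \<bar>x\<bar> < conv_radius (qseries_coeff q g \<nu>)"
    and "1 \<le> \<alpha>"
  shows "0 \<le> gen_turanian q g \<mu> (real \<alpha>) \<beta> x \<and>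
    (\<not> (\<mu> = - 1 \<and> (\<alpha> = 1 \<or> \<beta> = 1) \<and> (\<forall>n\<ge>1. g n = 0)) \<and>
     \<not> (\<mu> = - 1 \<and> \<alpha> = 1 \<and> \<beta> = 1 \<and> (\<exists>r. \<forall>n. g n = g 0 * r ^ n)) \<longrightarrow>
     0 < gen_turanian q g \<mu> (real \<alpha>) \<beta> x)"
  using \<open>1 \<le> \<alpha>\<close>
proof (induction \<alpha> rule: dec_induct)
  case base
  then show ?case
    using gen_turanian_one_nonneg [OF q g \<mu> x] gen_turanian_one_pos [OF q g \<mu> x] by auto
next
  case (step n)
  define G where "G \<nu> = qseries q g \<nu> x" for \<nu>
  have x': "ereal x < conv_radius (qseries_coeff q g \<nu>)" for \<nu>
    using x(1) x(2) [of \<nu>] by simp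
  have G_nonneg: "0 \<le> G \<nu>" if "0 \<le> \<nu>" for \<nu>
    unfolding G_def using q g x x' that by (intro qseries_nonneg)
  have G_pos: "0 < G \<nu>" if "0 < \<nu>" for \<nu>
    unfolding G_def using q g x x' that by (intro qseries_pos) auto
  have n: "1 \<le> real n"
    using step by simp
  let ?A = "G (\<mu> + real n + 1) * G (\<mu> + real n + \<beta>) - G (\<mu> + real n) * G (\<mu> + real n + \<beta> + 1)"
  let ?B = "G (\<mu> + real n) * G (\<mu> + \<beta>) - G \<mu> * G (\<mu> + real n + \<beta>)"
  let ?C = "G (\<mu> + real n + 1) * G (\<mu> + \<beta>) - G \<mu> * G (\<mu> + real n + \<beta> + 1)"
  \<comment> \<open>The base \<mu> + n is at least 0, so neither exception at -1 applies.\<close>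
  have A: "0 < ?A"
    using gen_turanian_one_pos [OF q g _ _ _ x, of "\<mu> + real n" \<beta>] \<mu> n
    by (simp add: gen_turanian_def G_def add_ac)
  have B: "?B = gen_turanian q g \<mu> (real n) \<beta> x"
    by (simp add: gen_turanian_def G_def)
  have C: "?C = gen_turanian q g \<mu> (real (Suc n)) \<beta> x"
    by (simp add: gen_turanian_def G_def add_ac)
  have pos: "0 < G (\<mu> + real n + \<beta>)" "0 < G (\<mu> + real n + \<beta> + 1)"
    using \<mu> n by (auto intro!: G_pos)
  have nonneg: "0 \<le> G (\<mu> + \<beta>)"
    using \<mu> by (intro G_nonneg) auto
  have key: "G (\<mu> + real n + \<beta>) * ?C = G (\<mu> + \<beta>) * ?A + G (\<mu> + real n + \<beta> + 1) * ?B"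
    by (simp add: algebra_simps)
  have B0: "0 \<le> ?B"
    using step.IH B by simp
  have "0 \<le> G (\<mu> + real n + \<beta>) * ?C"
    unfolding key using A B0 pos nonneg by simp
  then have "0 \<le> ?C"
    using pos by (simp add: zero_le_mult_iff)
  \<comment> \<open>For \<mu> = -1 the first summand of \<open>key\<close> is positive through G
    (\<beta> - 1); for \<mu> > -1 the induction hypothesis has no exception and makes the second one
    positive.\<close>
  moreover have "0 < ?C" if ex: "\<not> (\<mu> = - 1 \<and> \<beta> = 1 \<and> (\<forall>n\<ge>1. g n = 0))"
  proof -
    have "0 < G (\<mu> + \<beta>) \<or> 0 < ?B"
    proof (cases "\<mu> = - 1")
      case True
      then have "0 < G (\<mu> + \<beta>)"
        unfolding G_def using q g x x' \<mu> ex by (intro qseries_pos) auto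
      then show ?thesis ..
    next
      case False
      then show ?thesis
        using step.IH B by simp
    qed
    then have "0 < G (\<mu> + real n + \<beta>) * ?C"
      unfolding key using A B0 pos nonneg
      by (elim disjE) (intro add_pos_nonneg add_nonneg_pos mult_pos_pos mult_nonneg_nonneg; simp)+
    then show ?thesis
      using pos by (simp add: zero_less_mult_iff)
  qed
  ultimately show ?case
    unfolding C using step.hyps by auto
qed

text \<open>The cases exempted from strict positivity are genuine: there the Turanian, respectively
  the coefficient, is 0, because at \<mu> = -1 the values of 1 / \<open>qGamma\<close> at -1 and 0
  vanish, or because all weights g k * g (m - k) do.\<close>

theorem theorem3:
  fixes q :: real and g :: "nat \<Rightarrow> real"
  assumes q: "0 < q" "q < 1"
    and g: "doubly_positive g"
  shows "\<exists>R::ereal. 0 < R \<and>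
    (\<forall>\<nu>::real. conv_radius (qseries_coeff q g \<nu>) = R) \<and>
    (\<forall>(\<mu>::real) (\<alpha>::nat) (\<beta>::real).
       \<alpha> \<ge> 1 \<and> \<beta> > 0 \<and> \<mu> \<ge> max (- \<beta>) (- 1) \<longrightarrow>
       (\<forall>x::real. 0 < x \<and> ereal x < R \<longrightarrow>
          gen_turanian q g \<mu> (real \<alpha>) \<beta> x \<ge> 0 \<and>
          (\<not> (\<mu> = - 1 \<and> (\<alpha> = 1 \<or> \<beta> = 1) \<and> (\<forall>n\<ge>1. g n = 0)) \<and>
           \<not> (\<mu> = - 1 \<and> \<alpha> = 1 \<and> \<beta> = 1 \<and> (\<exists>r. \<forall>n. g n = g 0 * r ^ n)) \<longrightarrow>
           gen_turanian q g \<mu> (real \<alpha>) \<beta> x > 0)) \<and>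
       (real \<alpha> \<le> \<beta> + 1 \<longrightarrow>
          (\<exists>c::nat \<Rightarrow> real.
             (\<forall>x::real. ereal \<bar>x\<bar> < R \<longrightarrow>
                (\<lambda>m. c m * x ^ m) sums gen_turanian q g \<mu> (real \<alpha>) \<beta> x) \<and>
             (\<forall>m. c m \<ge> 0 \<and>
                ((\<exists>k\<le>m. g k * g (m - k) \<noteq> 0) \<and>
                 \<not> (\<mu> = - 1 \<and> m = 0 \<and> (\<alpha> = 1 \<or> \<beta> = 1)) \<and>
                 \<not> (\<mu> = - 1 \<and> \<alpha> = 1 \<and> \<beta> = 1 \<and> (\<forall>k\<le>m. g k * g (m - k) = g 0 * g m)) \<longrightarrow>
                 c m > 0)))))"
proof -
  define R where "R = conv_radius (\<lambda>n. g n * (1 - q) ^ n)"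
  have R: "conv_radius (qseries_coeff q g \<nu>) = R" for \<nu>
    unfolding R_def by (rule conv_radius_qseries_coeff [OF q])
  show ?thesis
  proof (intro exI [of _ R] conjI allI impI, goal_cases)
    case 1
    show ?case
      unfolding R_def by (rule conv_radius_qseries_coeff_pos [OF q g])
  next
    case 2
    show ?case
      by (rule R)
  next
    case (3 \<mu> \<alpha> \<beta> x)
    then show ?case
      using gen_turanian_nonneg_and_pos [OF q g, of \<mu> \<beta> x \<alpha>] by (simp add: R)
  next
    case (4 \<mu> \<alpha> \<beta> x)
    then show ?case
      using gen_turanian_nonneg_and_pos [OF q g, of \<mu> \<beta> x \<alpha>] by (simp add: R)
  next
    case (5 \<mu> \<alpha> \<beta>)
    then have "max (- \<beta>) (- 1) \<le> \<mu>" "0 < \<beta>" "1 \<le> \<alpha>"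
      by auto
    then show ?case
      using 5 by (intro exI [of _ "turan_coeff q g \<mu> (real \<alpha>) \<beta>"] conjI allI impI)
        (auto simp: R intro!: turan_coeff_sums turan_coeff_nonneg [OF q g] turan_coeff_pos [OF q g])
  qed
qed

end
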